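(* Let $p$ be an odd prime, let $k\geq 1$, and let $G$ be a finite $p$-central group of height $k$. Then $G$ is $p$-nilpotent, i.e., if $P\in\mathrm{Syl}_p(G)$ is a Sylow $p$-subgroup of $G$, then $P$ has a normal complement in $G$.
   Context: For a finite group $G$, a prime $p$ and $i\geq 0$, put $\Omega_i(G,p)=\langle g\in G\mid g^{p^i}=1\rangle$. Let $\zeta_k(G)$ denote the $k$-th term of the ascending (upper) central series of $G$, with $\zeta_1(G)=\mathrm{Z}(G)$. For $i,k\geq 1$ the group $G$ is called $p^i$-central of height $k$ if $\Omega_i(G,p)\leq\zeta_k(G)$. In particular, $G$ is $p$-central of height $k$ if $\Omega_1(G,p)\leq \zeta_k(G)$. *)

theory Defs
  imports "HOL-Algebra.Algebra"
begin

definition group_center :: "('a, 'b) monoid_scheme \<Rightarrow> 'a set" where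
  "group_center G = {z \<in> carrier G. \<forall>x \<in> carrier G. z \<otimes>\<^bsub>G\<^esub> x = x \<otimes>\<^bsub>G\<^esub> z}"

primrec upper_central :: "('a, 'b) monoid_scheme \<Rightarrow> nat \<Rightarrow> 'a set" where
  "upper_central G 0 = {\<one>\<^bsub>G\<^esub>}"
| "upper_central G (Suc k) =
     {x \<in> carrier G. upper_central G k #>\<^bsub>G\<^esub> x \<in> group_center (G Mod upper_central G k)}"

definition Omega :: "('a, 'b) monoid_scheme \<Rightarrow> nat \<Rightarrow> nat \<Rightarrow> 'a set" where
  "Omega G p i = generate G {g \<in> carrier G. g [^]\<^bsub>G\<^esub> (p ^ i) = \<one>\<^bsub>G\<^esub>}"

text \<open>\<^term>\<open>p_pow_central G p i k\<close>: the group is $p^i$-central of height $k$.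
  The notion is intended for finite groups, primes \<^term>\<open>p\<close> and \<^term>\<open>i \<ge> 1\<close>, \<^term>\<open>k \<ge> 1\<close>.\<close>

definition p_pow_central :: "('a, 'b) monoid_scheme \<Rightarrow> nat \<Rightarrow> nat \<Rightarrow> nat \<Rightarrow> bool" where
  "p_pow_central G p i k \<longleftrightarrow> Omega G p i \<subseteq> upper_central G k"

abbreviation p_central :: "('a, 'b) monoid_scheme \<Rightarrow> nat \<Rightarrow> nat \<Rightarrow> bool" where
  "p_central G p k \<equiv> p_pow_central G p 1 k"

definition Syl :: "nat \<Rightarrow> ('a, 'b) monoid_scheme \<Rightarrow> 'a set set" where
  "Syl p G = {P. subgroup P G \<and> card P = p ^ multiplicity p (order G)}"

definition normal_complement :: "'a set \<Rightarrow> 'a set \<Rightarrow> ('a, 'b) monoid_scheme \<Rightarrow> bool" where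
  "normal_complement N H G \<longleftrightarrow>
     N \<lhd> G \<and> N \<inter> H = {\<one>\<^bsub>G\<^esub>} \<and> N <#>\<^bsub>G\<^esub> H = carrier G"

definition p_nilpotent :: "nat \<Rightarrow> ('a, 'b) monoid_scheme \<Rightarrow> bool" where
  "p_nilpotent p G \<longleftrightarrow> (\<forall>P \<in> Syl p G. \<exists>N. normal_complement N P G)"

lemma (in group) mem_upper_central_Suc_iff:
  assumes "upper_central G k \<lhd> G"
  shows "x \<in> upper_central G (Suc k) \<longleftrightarrow>
    x \<in> carrier G \<and> (\<forall>g \<in> carrier G. x \<otimes> g \<otimes> inv (g \<otimes> x) \<in> upper_central G k)"
proof -
  let ?Z = "upper_central G k"
  interpret Z: normal ?Z G by fact
  have key: "(?Z #> x) <#> (?Z #> g) = (?Z #> g) <#> (?Z #> x) \<longleftrightarrow>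
      x \<otimes> g \<otimes> inv (g \<otimes> x) \<in> ?Z" if x: "x \<in> carrier G" and g: "g \<in> carrier G" for g
  proof -
    have "(?Z #> x) <#> (?Z #> g) = (?Z #> g) <#> (?Z #> x) \<longleftrightarrow>
        ?Z #> (x \<otimes> g) = ?Z #> (g \<otimes> x)"
      using x g by (simp add: Z.rcos_sum)
    also have "\<dots> \<longleftrightarrow> x \<otimes> g \<in> ?Z #> (g \<otimes> x)"
      using x g rcos_self repr_independence Z.subgroup_axioms m_closed by metis
    also have "\<dots> \<longleftrightarrow> x \<otimes> g \<otimes> inv (g \<otimes> x) \<in> ?Z"
      using x g by (metis Z.rcos_module is_group m_closed)
    finally show ?thesis .
  qed
  have "?Z #> x \<in> group_center (G Mod ?Z) \<longleftrightarrow>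
      (\<forall>g \<in> carrier G. (?Z #> x) <#> (?Z #> g) = (?Z #> g) <#> (?Z #> x))"
    if "x \<in> carrier G"
    using that unfolding group_center_def FactGroup_def RCOSETS_def by simp blast
  then show ?thesis
    using key by (cases "x \<in> carrier G") simp_all
qed

lemma (in group) upper_central_normal: "upper_central G k \<lhd> G"
proof (induction k)
  case 0
  show ?case by (simp add: one_is_normal)
next
  case (Suc k)
  let ?Z = "upper_central G k" and ?Q = "G Mod upper_central G k"
  interpret Z: normal ?Z G by fact
  interpret Q: group ?Q by (rule Z.factorgroup_is_group)
  interpret h: group_hom G ?Q "\<lambda>x. ?Z #> x"
    by (simp add: Q.group_axioms group_hom.intro group_hom_axioms.intro Z.r_coset_hom_Mod)
  have sub: "subgroup (upper_central G (Suc k)) G"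
  proof (rule subgroupI)
    show "upper_central G (Suc k) \<subseteq> carrier G" by auto
    have "\<one> \<in> upper_central G (Suc k)"
      using Q.l_one Q.r_one Q.one_closed h.hom_one unfolding upper_central.simps group_center_def
      by simp
    then show "upper_central G (Suc k) \<noteq> {}" by blast
  next
    fix a assume a: "a \<in> upper_central G (Suc k)"
    then have ac: "a \<in> carrier G" by simp
    have "inv\<^bsub>?Q\<^esub> (?Z #> a) \<otimes>\<^bsub>?Q\<^esub> y = y \<otimes>\<^bsub>?Q\<^esub> inv\<^bsub>?Q\<^esub> (?Z #> a)"
      if y: "y \<in> carrier ?Q" for y
    proof -
      have "(?Z #> a) \<otimes>\<^bsub>?Q\<^esub> y = y \<otimes>\<^bsub>?Q\<^esub> (?Z #> a)"
        using a y by (simp add: group_center_def)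
      then show ?thesis
        using y h.hom_closed[OF ac] by (metis Q.inv_closed Q.inv_solve_left Q.inv_solve_right' Q.m_assoc Q.m_closed)
    qed
    then show "inv a \<in> upper_central G (Suc k)"
      using ac h.hom_inv[OF ac] by (simp add: group_center_def)
  next
    fix a b assume a: "a \<in> upper_central G (Suc k)" and b: "b \<in> upper_central G (Suc k)"
    have ac: "a \<in> carrier G" and bc: "b \<in> carrier G" using a b by auto
    have "(?Z #> a) \<otimes>\<^bsub>?Q\<^esub> (?Z #> b) \<otimes>\<^bsub>?Q\<^esub> y = y \<otimes>\<^bsub>?Q\<^esub> ((?Z #> a) \<otimes>\<^bsub>?Q\<^esub> (?Z #> b))"
      if y: "y \<in> carrier ?Q" for y
    proof -
      have "(?Z #> a) \<otimes>\<^bsub>?Q\<^esub> y = y \<otimes>\<^bsub>?Q\<^esub> (?Z #> a)" "(?Z #> b) \<otimes>\<^bsub>?Q\<^esub> y = y \<otimes>\<^bsub>?Q\<^esub> (?Z #> b)"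
        using a b y by (auto simp: group_center_def)
      then show ?thesis
        using y h.hom_closed[OF ac] h.hom_closed[OF bc] by (metis Q.m_assoc)
    qed
    then show "a \<otimes> b \<in> upper_central G (Suc k)"
      using ac bc h.hom_mult[OF ac bc] Q.m_closed[OF h.hom_closed[OF ac] h.hom_closed[OF bc]]
      by (simp add: group_center_def)
  qed
  show ?case
    unfolding normal_inv_iff
  proof (intro conjI sub ballI)
    fix x a assume x: "x \<in> carrier G" and a: "a \<in> upper_central G (Suc k)"
    then have ac: "a \<in> carrier G" by simp
    have "(?Z #> a) \<otimes>\<^bsub>?Q\<^esub> (?Z #> x) = (?Z #> x) \<otimes>\<^bsub>?Q\<^esub> (?Z #> a)"
      using a h.hom_closed[OF x] by (simp add: group_center_def)
    then have "?Z #> (x \<otimes> a \<otimes> inv x) = ?Z #> a"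
      using x ac by (metis Q.inv_solve_right h.hom_closed h.hom_inv h.hom_mult inv_closed m_closed)
    then show "x \<otimes> a \<otimes> inv x \<in> upper_central G (Suc k)"
      using a x ac by simp
  qed
qed

lemma (in group) upper_central_1: "upper_central G 1 = group_center G"
proof -
  have "x \<otimes> g \<otimes> inv (g \<otimes> x) = \<one> \<longleftrightarrow> x \<otimes> g = g \<otimes> x"
    if "x \<in> carrier G" "g \<in> carrier G" for x g
    using that by (metis inv_solve_right' l_one m_closed one_closed)
  then show ?thesis
    using mem_upper_central_Suc_iff[of 0, OF upper_central_normal]
    by (auto simp: group_center_def simp del: upper_central.simps(2))
qed

end

theory Submission
  imports Defs
begin

text \<open>Call an element \<open>p\<close>-regular if its order is prime
  to \<open>p\<close>. A commutator of a \<open>p\<close>-regular element with an element of order \<open>p\<close> lying in the upper central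
  series can be pushed down that series one step at a time, so \<open>p\<close>-regular elements centralize all
  elements of order \<open>p\<close>. Passing to the centralizer of the latter, one may assume that elements of
  order \<open>p\<close> are central. In a Sylow subgroup \<open>P\<close> of exponent \<open>p ^ (d + 1)\<close>, equality of \<open>p ^ d\<close>-th
  powers of \<open>x\<close> and \<open>y\<close> then forces \<open>x y\<inverse>\<close> into \<open>W = {x \<in> P. x ^ (p ^ d) = 1}\<close> (here \<open>p\<close> is odd), so
  \<open>W\<close> is a proper normal subgroup of \<open>P\<close> with abelian quotient. As \<open>p ^ d\<close>-th powers are central in
  \<open>G\<close>, the map \<open>P \<rightarrow> P / W\<close> is constant on \<open>G\<close>-conjugacy classes, and its transfer is a nontrivial
  homomorphism from \<open>G\<close> to a \<open>p\<close>-group. Its kernel contains all \<open>p\<close>-regular elements; induction on the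
  order shows that they form a subgroup, which is the complement.\<close>

section \<open>Commutators and power identities\<close>

context group
begin

lemma inv_mult_cancel [simp]:
  "x \<in> carrier G \<Longrightarrow> y \<in> carrier G \<Longrightarrow> inv x \<otimes> (x \<otimes> y) = y"
  "x \<in> carrier G \<Longrightarrow> y \<in> carrier G \<Longrightarrow> x \<otimes> (inv x \<otimes> y) = y"
  by (simp_all flip: m_assoc)

lemma commutator_eq_one_iff:
  assumes "x \<in> carrier G" "y \<in> carrier G"
  shows "x \<otimes> y \<otimes> inv (y \<otimes> x) = \<one> \<longleftrightarrow> x \<otimes> y = y \<otimes> x"
  using assms by (metis inv_solve_right' l_one m_closed one_closed)

lemma pow_commute:
  assumes "x \<in> carrier G" "y \<in> carrier G" "x \<otimes> y = y \<otimes> x"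
  shows "x [^] (n::nat) \<otimes> y = y \<otimes> x [^] n"
proof (induction n)
  case (Suc n)
  then show ?case using assms by (metis m_assoc nat_pow_Suc nat_pow_closed)
qed (use assms in simp)

lemma pow_conj:
  assumes "x \<in> carrier G" "y \<in> carrier G"
  shows "(y \<otimes> x \<otimes> inv y) [^] (n::nat) = y \<otimes> x [^] n \<otimes> inv y"
  by (induction n) (use assms in \<open>simp_all add: m_assoc\<close>)

text \<open>Each of the \<open>n\<close> factors \<open>b\<close> picks up one \<open>z\<close> on
  its way past \<open>a\<close>; \<open>z\<close> is the commutator of \<open>b\<close> and
  \<open>a\<close> and commutes with both.\<close>

lemma pow_mult_skew:
  assumes a: "a \<in> carrier G" and b: "b \<in> carrier G" and z: "z \<in> carrier G"
    and za: "z \<otimes> a = a \<otimes> z" and zb: "z \<otimes> b = b \<otimes> z" and ba: "b \<otimes> a = z \<otimes> (a \<otimes> b)"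
  shows "b [^] n \<otimes> a = z [^] n \<otimes> (a \<otimes> b [^] (n::nat))"
proof (induction n)
  case (Suc n)
  have "b [^] Suc n \<otimes> a = b [^] n \<otimes> z \<otimes> (a \<otimes> b)"
    using a b z ba by (simp add: m_assoc)
  also have "\<dots> = z \<otimes> (b [^] n \<otimes> a) \<otimes> b"
    using a b z pow_commute[OF b z zb[symmetric], of n] by (simp flip: m_assoc)
  also have "\<dots> = z \<otimes> z [^] n \<otimes> (a \<otimes> b [^] Suc n)"
    using a b z Suc by (simp add: m_assoc)
  also have "z \<otimes> z [^] n = z [^] Suc n" using z by (rule nat_pow_Suc2[symmetric])
  finally show ?case .
qed (use assms in simp)

text \<open>Collection in class two: the \<open>a\<close> numbered i, counting from 0, passes i
  factors \<open>b\<close> and contributes \<open>z [^] i\<close>. The exponent of \<open>z\<close>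
  is thus n(n-1)/2.\<close>

lemma mult_pow_class_2:
  assumes a: "a \<in> carrier G" and b: "b \<in> carrier G" and z: "z \<in> carrier G"
    and za: "z \<otimes> a = a \<otimes> z" and zb: "z \<otimes> b = b \<otimes> z" and ba: "b \<otimes> a = z \<otimes> (a \<otimes> b)"
  shows "(a \<otimes> b) [^] n = z [^] (\<Sum>{..<n}) \<otimes> (a [^] n \<otimes> b [^] (n::nat))"
proof (induction n)
  case (Suc n)
  let ?T = "\<Sum>{..<n}"
  have "(a \<otimes> b) [^] Suc n = z [^] ?T \<otimes> a [^] n \<otimes> (b [^] n \<otimes> a) \<otimes> b"
    using a b z Suc by (simp add: m_assoc)
  also have "\<dots> = z [^] ?T \<otimes> (a [^] n \<otimes> z [^] n) \<otimes> (a \<otimes> b [^] Suc n)"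
    using a b z pow_mult_skew[OF assms] by (simp add: m_assoc)
  also have "a [^] n \<otimes> z [^] n = z [^] n \<otimes> a [^] n"
    using a z za by (metis nat_pow_closed pow_commute)
  also have "z [^] ?T \<otimes> (z [^] n \<otimes> a [^] n) \<otimes> (a \<otimes> b [^] Suc n)
      = (z [^] ?T \<otimes> z [^] n) \<otimes> (a [^] Suc n \<otimes> b [^] Suc n)"
    using a b z by (simp add: m_assoc)
  also have "z [^] ?T \<otimes> z [^] n = z [^] (\<Sum>{..<Suc n})"
    using z by (simp add: nat_pow_mult)
  finally show ?case .
qed (use assms in simp)

lemma upper_central_carrier: "upper_central G k \<subseteq> carrier G"
  using upper_central_normal normal_imp_subgroup subgroup.subset by blast

text \<open>The conjugate \<^term>\<open>y \<otimes> x \<otimes> inv y\<close> of \<^term>\<open>x\<close> has the same \<^term>\<open>p\<close>-th power as \<^term>\<open>x\<close>, and its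
  commutator with \<^term>\<open>x\<close> lies one step lower in the upper central series than that of \<^term>\<open>x\<close> and \<^term>\<open>y\<close>.\<close>
lemma pow_prime_eq_imp_aux:
  fixes p :: nat
  assumes p: "odd p"
    and cent: "\<And>z g. z \<in> carrier G \<Longrightarrow> g \<in> carrier G \<Longrightarrow> z [^] p = \<one> \<Longrightarrow> z \<otimes> g = g \<otimes> z"
    and x: "x \<in> carrier G"
  shows "y \<in> carrier G \<Longrightarrow> x [^] p = y [^] p \<Longrightarrow> x \<otimes> y \<otimes> inv (y \<otimes> x) \<in> upper_central G j
    \<Longrightarrow> (x \<otimes> inv y) [^] p = \<one>"
proof (induction j arbitrary: y)
  case 0
  then have xy: "x \<otimes> y = y \<otimes> x" using x commutator_eq_one_iff by simp
  then have "x \<otimes> inv y = inv y \<otimes> x"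
    using x 0 by (metis inv_closed inv_solve_left inv_solve_right m_assoc m_closed)
  then have "(x \<otimes> inv y) [^] p = x [^] p \<otimes> inv y [^] p"
    using x 0(1) by (intro pow_mult_distrib) auto
  then show ?case using x 0 by (simp add: nat_pow_inv)
next
  case (Suc j)
  note y = Suc.prems(1)
  define x' where "x' = y \<otimes> x \<otimes> inv y"
  define z where "z = x \<otimes> y \<otimes> inv (y \<otimes> x)"
  have x': "x' \<in> carrier G" and zc: "z \<in> carrier G" using x y by (simp_all add: x'_def z_def)
  have zx: "z = x \<otimes> inv x'" using x y by (simp add: x'_def z_def m_assoc inv_mult_group)
  have inv_z: "inv z = x' \<otimes> inv x" using zx x x' by (simp add: inv_mult_group)
  have "x [^] p = x' [^] p"
  proof -
    have "x' [^] p = y \<otimes> y [^] p \<otimes> inv y" using x y Suc.prems by (simp add: x'_def pow_conj)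
    also have "\<dots> = x [^] p" using y Suc.prems(2) by (simp add: m_assoc flip: pow_commute[OF y y refl])
    finally show ?thesis by simp
  qed
  \<comment> \<open>As \<open>x' = inv z \<otimes> x\<close>, conjugation by \<open>inv z\<close>
    turns the commutator of \<open>z\<close> and \<open>x\<close> into that of \<open>x\<close> and
    \<open>x'\<close>. The former lies in term \<open>j\<close> because \<open>z\<close> lies in
    term \<open>Suc j\<close>.\<close>
  moreover have "x \<otimes> x' \<otimes> inv (x' \<otimes> x) \<in> upper_central G j"
  proof -
    have "z \<otimes> x \<otimes> inv (x \<otimes> z) \<in> upper_central G j"
      using Suc.prems(3) x unfolding mem_upper_central_Suc_iff[OF upper_central_normal] z_def by blast
    then have "inv z \<otimes> (z \<otimes> x \<otimes> inv (x \<otimes> z)) \<otimes> z \<in> upper_central G j"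
      using normal.inv_op_closed1[OF upper_central_normal zc] by blast
    moreover have "inv z \<otimes> (z \<otimes> x \<otimes> inv (x \<otimes> z)) \<otimes> z = x \<otimes> x' \<otimes> inv (x' \<otimes> x)"
      using x x' zc by (simp add: inv_mult_group inv_z m_assoc) (simp add: zx m_assoc)
    ultimately show ?thesis by simp
  qed
  \<comment> \<open>The induction hypothesis is applied to \<open>x'\<close>, for which
    \<open>x \<otimes> inv x' = z\<close>. Having trivial \<open>p\<close>-th power,
    \<open>z\<close> is central, so the class-two power formula is available for \<open>x\<close>
    and \<open>inv y\<close>.\<close>
  ultimately have "z [^] p = \<one>" using Suc.IH[OF x'] zx by simp
  then have zg: "z \<otimes> g = g \<otimes> z" if "g \<in> carrier G" for g using cent zc that by blast
  have zy: "z \<otimes> inv y = inv y \<otimes> z" and "z \<otimes> x = x \<otimes> z" using x y zg by auto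
  moreover have "inv y \<otimes> x = z \<otimes> (x \<otimes> inv y)"
  proof -
    have "z \<otimes> (y \<otimes> x) = x \<otimes> y" using x y by (simp add: z_def m_assoc)
    then have "inv y \<otimes> x = inv y \<otimes> z \<otimes> (y \<otimes> x) \<otimes> inv y"
      using x y zc by (simp add: m_assoc)
    also have "inv y \<otimes> z = z \<otimes> inv y" using zy by simp
    finally show ?thesis using x y zc by (simp add: m_assoc)
  qed
  ultimately have "(x \<otimes> inv y) [^] p = z [^] (\<Sum>{..<p}) \<otimes> (x [^] p \<otimes> inv y [^] p)"
    using x y zc by (intro mult_pow_class_2) auto
  moreover have "z [^] (\<Sum>{..<p}) = \<one>"
  proof -
    \<comment> \<open>Oddness of \<open>p\<close> enters here: p(p-1)/2 is a multiple of
      \<open>p\<close>, which kills the correction term.\<close>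
    have "p dvd \<Sum>{..<p}"
    proof -
      have "(\<Sum>{..<p}) = p * ((p - 1) div 2)"
        using p by (simp add: lessThan_atLeast0 Sum_Ico_nat div_mult_swap)
      then show ?thesis by simp
    qed
    then obtain m where m: "\<Sum>{..<p} = p * m" by blast
    have "z [^] (p * m) = (z [^] p) [^] m" using zc by (simp add: nat_pow_pow)
    then show ?thesis using \<open>z [^] p = \<one>\<close> m by simp
  qed
  ultimately show ?case using x y Suc.prems by (simp add: nat_pow_inv)
qed

section \<open>Nilpotency of p-groups and equality of p-power powers\<close>

lemma center_normal: "group_center G \<lhd> G"
  using upper_central_normal[of 1] upper_central_1 by simp

text \<open>Class equation: with a trivial center, \<open>{\<one>}\<close> would be the only
  conjugacy class of size one. All other classes have size divisible by \<open>p\<close>, so the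
  order would be 1 modulo \<open>p\<close>.\<close>

lemma p_group_center_nontrivial:
  assumes p: "Factorial_Ring.prime p" and n: "order G = p ^ n" and nt: "carrier G \<noteq> {\<one>}"
  shows "group_center G \<noteq> {\<one>}"
proof
  assume triv: "group_center G = {\<one>}"
  have fin: "finite (carrier G)"
    using n p by (simp add: prime_gt_0_nat flip: order_gt_0_iff_finite)
  define \<phi> where "\<phi> = (\<lambda>g. \<lambda>h\<in>carrier G. g \<otimes> h \<otimes> inv g)"
  interpret group_action G "carrier G" \<phi>
    unfolding \<phi>_def by (rule action_by_conjugation)
  have orb1: "orbit G \<phi> \<one> = {\<one>}" 
    by (auto simp: orbit_def \<phi>_def intro!: exI[of _ \<one>])
  have orb: "p dvd card (orbit G \<phi> x)" if x: "x \<in> carrier G" "x \<noteq> \<one>" for x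
  proof -
    have "card (orbit G \<phi> x) dvd p ^ n"
      using orbit_stabilizer_theorem[OF x(1)] n by (metis dvd_triv_left)
    then obtain i where i: "card (orbit G \<phi> x) = p ^ i"
      using divides_primepow_nat[OF p] by blast
    have "i \<noteq> 0"
    proof
      assume "i = 0"
      then obtain y where y: "orbit G \<phi> x = {y}" using i by (auto simp: card_1_singleton_iff)
      have "g \<otimes> x \<otimes> inv g = y" if "g \<in> carrier G" for g
        using y that x by (auto simp: orbit_def \<phi>_def)
      from this[OF one_closed] this have "g \<otimes> x \<otimes> inv g = x" if "g \<in> carrier G" for g
        using that x by simp
      then have "x \<otimes> g = g \<otimes> x" if "g \<in> carrier G" for g
        using that x by (metis inv_solve_right m_closed)
      then show False using triv x by (auto simp: group_center_def)
    qed
    then show ?thesis using i by simp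
  qed
  have finO: "finite (orbits G (carrier G) \<phi>)"
    using fin by (auto simp: orbits_def Setcompr_eq_image)
  have mem: "{\<one>} \<in> orbits G (carrier G) \<phi>" using orb1 unfolding orbits_def by blast
  have "order G = (\<Sum>orb\<in>orbits G (carrier G) \<phi>. card orb)"
    using disjoint_sum[OF fin, of "\<lambda>_. 1::nat"] by (simp add: order_def)
  also have "\<dots> = 1 + (\<Sum>orb\<in>orbits G (carrier G) \<phi> - {{\<one>}}. card orb)"
    using sum.remove[OF finO mem, of card] by simp
  finally have "order G = 1 + (\<Sum>orb\<in>orbits G (carrier G) \<phi> - {{\<one>}}. card orb)" .
  moreover have "p dvd (\<Sum>orb\<in>orbits G (carrier G) \<phi> - {{\<one>}}. card orb)"
    using orb orb1 by (intro dvd_sum) (auto simp: orbits_def)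
  moreover have "p dvd order G"
  proof -
    have "order G \<noteq> 1" using nt order_one_triv_iff by simp
    then show ?thesis using n by (cases n) auto
  qed
  ultimately have "p dvd 1" by (metis dvd_add_left_iff)
  then show False using p by simp
qed

lemma order_FactGroup_dvd: "subgroup H G \<Longrightarrow> order (G Mod H) dvd order G"
  using dvd_triv_left[of "card (rcosets H)" "card H"] lagrange[of H] by (simp add: order_def FactGroup_def)

lemma rcos_eq_iff:
  assumes H: "subgroup H G" and x: "x \<in> carrier G" and y: "y \<in> carrier G"
  shows "H #> x = H #> y \<longleftrightarrow> x \<otimes> inv y \<in> H"
proof -
  have "H #> x = H #> y \<longleftrightarrow> x \<in> H #> y"
    using rcos_self[OF x H] repr_independence[OF _ y H] by auto
  then show ?thesis using subgroup.rcos_module[OF H is_group y x] by simp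
qed

text \<open>If no term were the whole group, each quotient by a term would be a nontrivial
  \<open>p\<close>-group and have a nontrivial center. The series would then increase strictly
  forever inside a finite group.\<close>

lemma p_group_nilpotent:
  assumes p: "Factorial_Ring.prime p" and n: "order G = p ^ n"
  shows "\<exists>c. upper_central G c = carrier G"
proof (rule ccontr)
  assume not: "\<nexists>c. upper_central G c = carrier G"
  have fin: "finite (carrier G)"
    using n p by (simp add: prime_gt_0_nat flip: order_gt_0_iff_finite)
  have strict: "upper_central G k \<subset> upper_central G (Suc k)" for k
  proof -
    let ?Z = "upper_central G k" and ?Q = "G Mod upper_central G k"
    interpret Z: normal ?Z G by (rule upper_central_normal)
    interpret Q: group ?Q by (rule Z.factorgroup_is_group)
    have one: "?Z #> x = ?Z \<longleftrightarrow> x \<in> ?Z" if "x \<in> carrier G" for x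
      using that Z.rcos_const[OF is_group] coset_join1 Z.subgroup_axioms by blast
    have "order ?Q dvd p ^ n"
      using order_FactGroup_dvd[OF Z.subgroup_axioms] n by simp
    then obtain m where m: "order ?Q = p ^ m" using divides_primepow_nat[OF p] by blast
    obtain x where x: "x \<in> carrier G" "x \<notin> ?Z" using not Z.subset by blast
    then have "?Z #> x \<in> carrier ?Q" "?Z #> x \<noteq> ?Z" using one by (auto simp: carrier_FactGroup)
    then have "carrier ?Q \<noteq> {\<one>\<^bsub>?Q\<^esub>}" by auto
    from Q.p_group_center_nontrivial[OF p m this] obtain C where C: "C \<in> group_center ?Q" "C \<noteq> ?Z"
      using Q.center_normal[THEN normal_imp_subgroup, THEN subgroup.one_closed] by auto
    then obtain y where y: "y \<in> carrier G" "C = ?Z #> y"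
      by (auto simp: group_center_def carrier_FactGroup)
    then have "y \<in> upper_central G (Suc k)" "y \<notin> ?Z" using C one by auto
    moreover have "?Z \<subseteq> upper_central G (Suc k)"
    proof
      fix z assume z: "z \<in> ?Z"
      then have "?Z #> z = \<one>\<^bsub>?Q\<^esub>" using one by auto
      then show "z \<in> upper_central G (Suc k)"
        using Q.center_normal[THEN normal_imp_subgroup, THEN subgroup.one_closed] z by auto
    qed
    ultimately show ?thesis by blast
  qed
  have "k \<le> card (upper_central G k)" for k
  proof (induction k)
    case (Suc k)
    have "card (upper_central G k) < card (upper_central G (Suc k))"
      using strict fin upper_central_carrier by (meson finite_subset psubset_card_mono)
    then show ?case using Suc by simp
  qed simp
  from this[of "Suc (order G)"] show False
    using card_mono[OF fin upper_central_carrier[of "Suc (order G)"]] by (simp add: order_def)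
qed

text \<open>Nilpotency supplies a term of the upper central series containing the commutator of
  \<open>x\<close> and \<open>y\<close>, from which \<open>pow_prime_eq_imp_aux\<close> can
  descend.\<close>

lemma pow_prime_eq_imp:
  assumes p: "Factorial_Ring.prime p" and "odd p" and n: "order G = p ^ n"
    and cent: "\<And>z g. z \<in> carrier G \<Longrightarrow> g \<in> carrier G \<Longrightarrow> z [^] p = \<one> \<Longrightarrow> z \<otimes> g = g \<otimes> z"
    and xy: "x \<in> carrier G" "y \<in> carrier G" "x [^] p = y [^] p"
  shows "(x \<otimes> inv y) [^] p = \<one>"
proof -
  obtain c where "upper_central G c = carrier G" using p_group_nilpotent[OF p n] by blast
  then have "x \<otimes> y \<otimes> inv (y \<otimes> x) \<in> upper_central G c" using xy by simp
  then show ?thesis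
    by (intro pow_prime_eq_imp_aux[OF \<open>odd p\<close> _ xy] cent)
qed

text \<open>Induction on \<open>i\<close>: by the induction hypothesis the elements killed by
  \<open>p ^ i\<close> form a normal subgroup \<open>W\<close>. Centrality of elements killed by
  \<open>p\<close> passes to the quotient by \<open>W\<close>, so the case of \<open>p\<close>-th
  powers applies there and puts \<open>(x \<otimes> inv y) [^] p\<close> into
  \<open>W\<close>.\<close>

lemma pow_prime_power_eq_imp:
  assumes p: "Factorial_Ring.prime p" and "odd p" and n: "order G = p ^ n"
    and cent: "\<And>z g. z \<in> carrier G \<Longrightarrow> g \<in> carrier G \<Longrightarrow> z [^] p = \<one> \<Longrightarrow> z \<otimes> g = g \<otimes> z"
  shows "x \<in> carrier G \<Longrightarrow> y \<in> carrier G \<Longrightarrow> x [^] (p ^ i) = y [^] (p ^ i)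
    \<Longrightarrow> (x \<otimes> inv y) [^] (p ^ i) = \<one>"
proof (induction i arbitrary: x y)
  case (Suc i)
  define W where "W = {x \<in> carrier G. x [^] (p ^ i) = \<one>}"
  have "subgroup W G"
  proof
    fix x y assume "x \<in> W" "y \<in> W"
    then show "x \<otimes> y \<in> W"
      using Suc.IH[of x "inv y"] by (simp add: W_def nat_pow_inv)
  qed (auto simp: W_def nat_pow_inv)
  then have "W \<lhd> G"
    unfolding normal_inv_iff by (auto simp: W_def pow_conj)
  have WD: "x [^] p ^ i = \<one>" if "x \<in> W" for x using that by (simp add: W_def)
  have WI: "x \<in> W" if "x \<in> carrier G" "x [^] p ^ i = \<one>" for x using that by (simp add: W_def)
  interpret W: normal W G by fact
  let ?Q = "G Mod W"
  interpret Q: group ?Q by (rule W.factorgroup_is_group)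
  interpret h: group_hom G ?Q "\<lambda>x. W #> x"
    by (simp add: Q.group_axioms group_hom.intro group_hom_axioms.intro W.r_coset_hom_Mod)
  have eq: "W #> x = W #> y \<longleftrightarrow> x \<otimes> inv y \<in> W" if "x \<in> carrier G" "y \<in> carrier G" for x y
    using rcos_eq_iff[OF W.subgroup_axioms that] .
  have one: "W #> x = W \<longleftrightarrow> x \<in> W" if "x \<in> carrier G" for x
    using that W.rcos_const[OF is_group] coset_join1 W.subgroup_axioms by blast
  have step: "(x \<otimes> inv y) \<in> W" if "x \<in> carrier G" "y \<in> carrier G" "x [^] (p ^ i) = y [^] (p ^ i)" for x y
    using that by (intro WI Suc.IH) simp_all
  have "order ?Q dvd p ^ n"
    using order_FactGroup_dvd[OF W.subgroup_axioms] n by simp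
  then obtain m where m: "order ?Q = p ^ m" using divides_primepow_nat[OF p] by blast
  \<comment> \<open>If \<open>x [^] p\<close> lies in \<open>W\<close>, then
    \<open>x [^] (p ^ i)\<close> is killed by \<open>p\<close>, hence central, hence equal to the
    same power of every conjugate of \<open>x\<close>. The induction hypothesis then makes
    \<open>x\<close> agree with its conjugates modulo \<open>W\<close>.\<close>
  have centQ: "C \<otimes>\<^bsub>?Q\<^esub> D = D \<otimes>\<^bsub>?Q\<^esub> C"
    if C: "C \<in> carrier ?Q" "C [^]\<^bsub>?Q\<^esub> p = \<one>\<^bsub>?Q\<^esub>" and D: "D \<in> carrier ?Q" for C D
  proof -
    obtain x g where x: "x \<in> carrier G" "C = W #> x" and g: "g \<in> carrier G" "D = W #> g"
      using C D by (auto simp: carrier_FactGroup)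
    have "W #> (x [^] p) = W" using C x h.hom_nat_pow[OF x(1), of p] by simp
    then have "x [^] p \<in> W" by (rule iffD1[OF one[OF nat_pow_closed[OF x(1)]]])
    then have "(x [^] p) [^] p ^ i = \<one>" by (rule WD)
    then have "(x [^] p ^ i) [^] p = \<one>" using x by (metis nat_pow_pow mult.commute)
    then have "g \<otimes> x [^] p ^ i \<otimes> inv g = x [^] p ^ i"
      using cent[of "x [^] p ^ i" g] x g inv_solve_right[of "x [^] p ^ i" "g \<otimes> x [^] p ^ i" g] by simp
    then have "(x \<otimes> inv (g \<otimes> x \<otimes> inv g)) \<in> W"
      using x g by (intro step) (simp_all add: pow_conj)
    moreover have "x \<otimes> inv (g \<otimes> x \<otimes> inv g) = x \<otimes> g \<otimes> inv (g \<otimes> x)"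
      using x g by (simp add: inv_mult_group m_assoc)
    ultimately have "x \<otimes> g \<otimes> inv (g \<otimes> x) \<in> W" by simp
    then have "W #> (x \<otimes> g) = W #> (g \<otimes> x)"
      by (rule iffD2[OF eq, rotated 2]) (use x g in simp_all)
    then show ?thesis using x g by (metis h.hom_mult)
  qed
  have "(x [^] p) [^] p ^ i = (y [^] p) [^] p ^ i"
    using Suc.prems by (simp add: nat_pow_pow)
  then have "W #> (x [^] p) = W #> (y [^] p)" using step eq Suc.prems by simp
  then have "(W #> x) [^]\<^bsub>?Q\<^esub> p = (W #> y) [^]\<^bsub>?Q\<^esub> p"
    using Suc.prems h.hom_nat_pow by metis
  then have "((W #> x) \<otimes>\<^bsub>?Q\<^esub> inv\<^bsub>?Q\<^esub> (W #> y)) [^]\<^bsub>?Q\<^esub> p = \<one>\<^bsub>?Q\<^esub>"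
    using Suc.prems by (intro Q.pow_prime_eq_imp[OF p \<open>odd p\<close> m] centQ) auto
  then have "W #> ((x \<otimes> inv y) [^] p) = W"
    using Suc.prems h.hom_nat_pow h.hom_inv h.hom_mult by (metis inv_closed m_closed one_FactGroup)
  then have "(x \<otimes> inv y) [^] p \<in> W"
    by (rule iffD1[OF one, rotated]) (use Suc.prems(1,2) in simp)
  then show ?case using WD[of "(x \<otimes> inv y) [^] p"] Suc.prems by (simp add: nat_pow_pow)
qed (simp add: nat_pow_eone)

end

section \<open>Transfer\<close>

text \<open>The permutation splits \<open>T\<close> into cycles, and by \<open>cyc\<close> a cycle
  of length n contributes \<open>a [^] n\<close>. The induction removes one cycle \<open>U\<close>
  at a time. This is how the transfer is evaluated on elements of \<open>P\<close>.\<close>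

lemma (in comm_monoid) finprod_orbits:
  fixes \<sigma> :: "'c \<Rightarrow> 'c" and f :: "'c \<Rightarrow> 'a"
  assumes "finite T" "bij_betw \<sigma> T T" "f \<in> T \<rightarrow> carrier G" "a \<in> carrier G"
    and cyc: "\<And>t n. t \<in> T \<Longrightarrow> (\<sigma> ^^ n) t = t \<Longrightarrow> (\<Otimes>i\<in>{..<n}. f ((\<sigma> ^^ i) t)) = a [^] n"
  shows "finprod G f T = a [^] card T"
  using assms
proof (induction "card T" arbitrary: T rule: less_induct)
  case less
  show ?case
  proof (cases "T = {}")
    case False
    then obtain t where t: "t \<in> T" by blast
    have inT: "(\<sigma> ^^ i) t \<in> T" for i
      by (induction i) (use t less.prems(2) in \<open>auto simp: bij_betw_def\<close>)
    have inj: "inj_on (\<sigma> ^^ i) T" for i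
      using bij_betw_funpow[OF less.prems(2)] bij_betw_def by blast
    have "\<exists>n>0. (\<sigma> ^^ n) t = t"
    proof -
      \<comment> \<open>Pigeonhole: two iterates of \<open>t\<close> coincide, and injectivity of
        the iterates cancels the shorter one, so the sequence returns to \<open>t\<close>
        itself.\<close>
      have "\<not> inj_on (\<lambda>i. (\<sigma> ^^ i) t) UNIV"
        using inT less.prems(1) finite_imageD[of "\<lambda>i. (\<sigma> ^^ i) t" UNIV]
        by (meson finite_subset image_subsetI infinite_UNIV_nat)
      then obtain i j where "i < j" "(\<sigma> ^^ i) t = (\<sigma> ^^ j) t"
        using linorder_inj_onI'[of UNIV "\<lambda>i. (\<sigma> ^^ i) t"] by blast
      then have "(\<sigma> ^^ i) ((\<sigma> ^^ (j - i)) t) = (\<sigma> ^^ i) t"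
        using funpow_add[of i "j - i" \<sigma>] by simp
      then have "(\<sigma> ^^ (j - i)) t = t" using inj inT t by (meson inj_onD)
      then show ?thesis using \<open>i < j\<close> by (intro exI[of _ "j - i"]) simp
    qed
    then obtain n where n: "n > 0" "(\<sigma> ^^ n) t = t" and least: "\<And>m. m < n \<Longrightarrow> m > 0 \<Longrightarrow> (\<sigma> ^^ m) t \<noteq> t"
      using exists_least_iff[of "\<lambda>n. n > 0 \<and> (\<sigma> ^^ n) t = t"] by blast
    define U where "U = (\<lambda>i. (\<sigma> ^^ i) t) ` {..<n}"
    have injU: "inj_on (\<lambda>i. (\<sigma> ^^ i) t) {..<n}"
    proof (rule linorder_inj_onI')
      fix i j assume ij: "i \<in> {..<n}" "j \<in> {..<n}" "i < j"
      show "(\<sigma> ^^ i) t \<noteq> (\<sigma> ^^ j) t"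
      proof
        assume "(\<sigma> ^^ i) t = (\<sigma> ^^ j) t"
        then have "(\<sigma> ^^ i) ((\<sigma> ^^ (j - i)) t) = (\<sigma> ^^ i) t"
          using ij funpow_add[of i "j - i" \<sigma>] by simp
        then have "(\<sigma> ^^ (j - i)) t = t" using inj inT t by (meson inj_onD)
        then show False using least[of "j - i"] ij by (simp add: less_imp_diff_less)
      qed
    qed
    have UT: "U \<subseteq> T" using inT by (auto simp: U_def)
    have sU: "\<sigma> ` U = U"
    proof (rule card_subset_eq)
      show "finite U" by (simp add: U_def)
      show "\<sigma> ` U \<subseteq> U"
      proof clarify
        fix u assume "u \<in> U"
        then obtain i where i: "i < n" "u = (\<sigma> ^^ i) t" by (auto simp: U_def)
        show "\<sigma> u \<in> U"
        proof (cases "Suc i = n")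
          case True
          then have "\<sigma> u = (\<sigma> ^^ 0) t" using n i by (metis comp_apply funpow.simps(2) funpow_0)
          then show ?thesis unfolding U_def using n(1) by blast
        next
          case False
          then have "\<sigma> u = (\<sigma> ^^ Suc i) t" "Suc i < n" using i by auto
          then show ?thesis by (auto simp: U_def simp del: funpow.simps)
        qed
      qed
      show "card (\<sigma> ` U) = card U"
        using UT less.prems(2) by (intro card_image) (auto simp: bij_betw_def inj_on_subset)
    qed
    let ?R = "T - U"
    have "bij_betw \<sigma> ?R ?R"
    proof -
      have "\<sigma> ` (T - U) = \<sigma> ` T - \<sigma> ` U"
        using less.prems(2) UT by (intro inj_on_image_set_diff[of _ T]) (auto simp: bij_betw_def)
      then show ?thesis using less.prems(2) sU by (auto simp: bij_betw_def inj_on_subset)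
    qed
    moreover have "card ?R < card T"
    proof -
      have "t \<in> U" using n by (auto simp: U_def image_iff intro!: bexI[of _ 0])
      then show ?thesis using less.prems(1) t by (intro psubset_card_mono) auto
    qed
    ultimately have R: "finprod G f ?R = a [^] card ?R"
      using less.prems by (intro less.hyps) (auto simp: Pi_def)
    have "finprod G f U = (\<Otimes>i\<in>{..<n}. f ((\<sigma> ^^ i) t))"
      unfolding U_def using less.prems(3) inT injU by (intro finprod_reindex) auto
    also have "\<dots> = a [^] n" using less.prems(5) t n by blast
    also have "n = card U" by (simp add: U_def card_image[OF injU])
    finally have U: "finprod G f U = a [^] card U" .
    have "finprod G f T = finprod G f (U \<union> ?R)" using UT by (simp add: Un_absorb1)
    also have "\<dots> = finprod G f U \<otimes> finprod G f ?R"
      using less.prems UT by (intro finprod_Un_disjoint) (auto simp: finite_subset Pi_def)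
    also have "\<dots> = a [^] (card U + card ?R)"
      using R U less.prems by (simp add: nat_pow_mult)
    also have "card U + card ?R = card T"
      using UT less.prems(1) by (metis card_Diff_subset card_mono finite_subset le_add_diff_inverse)
    finally show ?thesis .
  qed simp
qed

text \<open>\<open>V\<close> multiplies the images of the elements of \<open>P\<close> by which
  translated coset representatives differ from the chosen ones. For \<open>x\<close> in
  \<open>P\<close> the cosets fall into cycles under right multiplication by \<open>x\<close>; by
  \<open>stable\<close> a cycle of length n contributes the n-th power of the image of
  \<open>x\<close>, and the lengths add up to the index.\<close>

lemma (in group) transfer:
  assumes fin: "finite (carrier G)" and P: "subgroup P G" and A: "comm_group A"
    and \<theta>: "\<theta> \<in> hom (G\<lparr>carrier := P\<rparr>) A"
    and stable: "\<And>x g. x \<in> P \<Longrightarrow> g \<in> carrier G \<Longrightarrow> g \<otimes> x \<otimes> inv g \<in> P \<Longrightarrow> \<theta> (g \<otimes> x \<otimes> inv g) = \<theta> x"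
  shows "\<exists>V. V \<in> hom G A \<and> (\<forall>x\<in>P. V x = \<theta> x [^]\<^bsub>A\<^esub> card (rcosets P))"
proof -
  interpret A: comm_group A by fact
  interpret P: subgroup P G by fact
  have \<theta>c: "\<theta> x \<in> carrier A" if "x \<in> P" for x using \<theta> that by (auto simp: hom_def)
  have \<theta>m: "\<theta> (x \<otimes> y) = \<theta> x \<otimes>\<^bsub>A\<^esub> \<theta> y" if "x \<in> P" "y \<in> P" for x y
    using \<theta> that by (auto simp: hom_def)
  have \<theta>1: "\<theta> \<one> = \<one>\<^bsub>A\<^esub>"
    using \<theta>m[of \<one> \<one>] \<theta>c[of \<one>] A.l_cancel_one' P.one_closed by auto
  have \<theta>pow: "\<theta> (x [^] n) = \<theta> x [^]\<^bsub>A\<^esub> n" if "x \<in> P" for x and n :: nat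
  proof (induction n)
    case (Suc n)
    have "x [^] n \<in> P" using that by (induction n) auto
    then show ?case using Suc that \<theta>m by simp
  qed (use \<theta>1 in simp)
  let ?T = "rcosets P"
  define r where "r C = (SOME x. x \<in> C)" for C :: "'a set"
  have r: "r C \<in> carrier G" "P #> r C = C" if C: "C \<in> ?T" for C
  proof -
    obtain g where g: "g \<in> carrier G" "C = P #> g" using C by (auto simp: RCOSETS_def)
    then have "r C \<in> C" unfolding r_def using rcos_self[OF g(1) P] by (metis someI)
    then show "r C \<in> carrier G" "P #> r C = C"
      using g P.elemrcos_carrier is_group repr_independence[OF _ g(1) P] by auto
  qed
  have finT: "finite ?T" using fin by (simp add: RCOSETS_def)
  have act: "C #> g \<in> ?T" if "C \<in> ?T" "g \<in> carrier G" for C g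
    using that r[OF that(1)] by (metis P.subset coset_mult_assoc m_closed rcosetsI)
  have act_mult: "C #> g #> h = C #> (g \<otimes> h)" if "C \<in> ?T" "g \<in> carrier G" "h \<in> carrier G" for C g h
    using that P.rcosets_carrier is_group by (simp add: coset_mult_assoc)
  have act_one: "C #> \<one> = C" if "C \<in> ?T" for C
    using that P.rcosets_carrier is_group by simp
  have bij: "bij_betw (\<lambda>C. C #> g) ?T ?T" if g: "g \<in> carrier G" for g
    by (rule bij_betw_byWitness[where f' = "\<lambda>C. C #> inv g"])
       (use g act act_mult act_one in auto)
  \<comment> \<open>This is the element of \<open>P\<close> with
    \<open>r C \<otimes> g = c C g \<otimes> r (C #> g)\<close>. Its cocycle identity makes
    \<open>V\<close> multiplicative once the cosets are reindexed by right multiplication.\<close>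
  define c where "c C g = r C \<otimes> g \<otimes> inv (r (C #> g))" for C g
  have cP: "c C g \<in> P" if "C \<in> ?T" "g \<in> carrier G" for C g
  proof -
    have "P #> (r C \<otimes> g) = C #> g" using that r by (metis P.subset coset_mult_assoc)
    then show ?thesis
      using rcos_eq_iff[OF P, of "r C \<otimes> g" "r (C #> g)"] that r act by (simp add: c_def)
  qed
  have cocycle: "c C (g \<otimes> h) = c C g \<otimes> c (C #> g) h"
    if "C \<in> ?T" "g \<in> carrier G" "h \<in> carrier G" for C g h
    using that r act by (simp add: c_def m_assoc act_mult)
  define V where "V g = (\<Otimes>\<^bsub>A\<^esub>C\<in>?T. \<theta> (c C g))" for g
  have "V \<in> hom G A"
  proof (rule homI)
    fix g h assume g: "g \<in> carrier G" and h: "h \<in> carrier G"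
    have "V (g \<otimes> h) = (\<Otimes>\<^bsub>A\<^esub>C\<in>?T. \<theta> (c C g) \<otimes>\<^bsub>A\<^esub> \<theta> (c (C #> g) h))"
      unfolding V_def using g h act cocycle cP \<theta>c \<theta>m by (intro A.finprod_cong') auto
    also have "\<dots> = V g \<otimes>\<^bsub>A\<^esub> (\<Otimes>\<^bsub>A\<^esub>C\<in>?T. \<theta> (c (C #> g) h))"
      unfolding V_def using g h act cP \<theta>c by (intro A.finprod_multf) auto
    also have "(\<Otimes>\<^bsub>A\<^esub>C\<in>?T. \<theta> (c (C #> g) h)) = (\<Otimes>\<^bsub>A\<^esub>C\<in>(\<lambda>C. C #> g) ` ?T. \<theta> (c C h))"
      using bij[OF g] g h act cP \<theta>c by (intro A.finprod_reindex[symmetric]) (auto simp: bij_betw_def)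
    also have "\<dots> = V h" using bij[OF g] by (simp add: V_def bij_betw_def)
    finally show "V (g \<otimes> h) = V g \<otimes>\<^bsub>A\<^esub> V h" .
  qed (use cP \<theta>c V_def in \<open>auto intro!: A.finprod_closed\<close>)
  moreover have "V x = \<theta> x [^]\<^bsub>A\<^esub> card ?T" if x: "x \<in> P" for x
  proof -
    have xc: "x \<in> carrier G" using x by simp
    have pow_act: "((\<lambda>C. C #> x) ^^ i) C = C #> x [^] i" if "C \<in> ?T" for C i
      by (induction i) (use that xc act_one act_mult in auto)
    \<comment> \<open>By the cocycle identity the product along the iterates of a coset
      telescopes.\<close>
    have "(\<Otimes>\<^bsub>A\<^esub>i\<in>{..<n}. \<theta> (c (((\<lambda>C. C #> x) ^^ i) C) x)) = \<theta> (c C (x [^] n))" if C: "C \<in> ?T" for C n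
    proof (induction n)
      case 0
      then show ?case using C r act_one \<theta>1 by (simp add: c_def)
    next
      case (Suc n)
      have "c C (x [^] Suc n) = c C (x [^] n) \<otimes> c (C #> x [^] n) x"
        using cocycle[OF C, of "x [^] n" x] xc by simp
      then show ?case
        using Suc C xc cP act \<theta>c \<theta>m 
        by (simp add: lessThan_Suc pow_act A.m_comm)
    qed
    \<comment> \<open>Once \<open>C\<close> returns to itself, \<open>c C (x [^] n)\<close> is the
      conjugate of \<open>x [^] n\<close> by \<open>r C\<close> and lies in \<open>P\<close>, so
      \<open>stable\<close> applies.\<close>
    moreover have "\<theta> (c C (x [^] n)) = \<theta> x [^]\<^bsub>A\<^esub> n"
      if C: "C \<in> ?T" and "((\<lambda>C. C #> x) ^^ n) C = C" for C n
    proof -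
      have "C #> x [^] n = C" using that pow_act by simp
      then have "c C (x [^] n) = r C \<otimes> x [^] n \<otimes> inv (r C)" by (simp add: c_def)
      moreover have "x [^] n \<in> P" using x by (induction n) auto
      ultimately show ?thesis using stable[of "x [^] n" "r C"] cP[OF C, of "x [^] n"] xc x C r \<theta>pow by simp
    qed
    ultimately show ?thesis
      unfolding V_def using finT bij[OF xc] cP xc \<theta>c x
      by (intro A.finprod_orbits[where \<sigma> = "\<lambda>C. C #> x"]) auto
  qed
  ultimately show ?thesis by blast
qed

section \<open>The p-regular elements\<close>

text \<open>For prime \<open>p\<close> the exponent \<open>m\<close> is nonzero, because
  \<open>coprime p 0\<close> forces \<open>p = 1\<close>; hence the order of \<open>x\<close>
  divides \<open>m\<close> and is itself prime to \<open>p\<close>.\<close>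

definition p_regular :: "nat \<Rightarrow> ('a, 'b) monoid_scheme \<Rightarrow> 'a set" where
  "p_regular p G = {x \<in> carrier G. \<exists>m. coprime p m \<and> x [^]\<^bsub>G\<^esub> m = \<one>\<^bsub>G\<^esub>}"

lemma p_regular_carrier_update:
  "K \<subseteq> carrier G \<Longrightarrow> p_regular p (G\<lparr>carrier := K\<rparr>) = p_regular p G \<inter> K"
  by (auto simp: p_regular_def nat_pow_def)

section \<open>Coprime orders and the upper central series\<close>

context group
begin

lemma pow_coprime_eq_one:
  assumes "x \<in> carrier G" "x [^] m = \<one>" "x [^] n = \<one>" "coprime m (n::nat)"
  shows "x = \<one>"
proof -
  have "ord x dvd m" "ord x dvd n" using assms pow_eq_id by auto
  then have "ord x = 1" using assms(4) coprime_common_divisor_nat by blast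
  then show ?thesis using assms(1) ord_eq_1 by blast
qed

lemma subgroup_pow_card:
  assumes "subgroup H G" "x \<in> H"
  shows "x [^] card H = \<one>"
proof -
  interpret H: group "G\<lparr>carrier := H\<rparr>"
    using assms(1) is_group by (rule subgroup.subgroup_is_group)
  show ?thesis
    using H.pow_order_eq_1[of x] assms(2) by (simp add: order_def nat_pow_def)
qed

text \<open>\<open>sylow_thm\<close> accepts any power of \<open>p\<close> dividing the order, not
  only the largest. Exponent 1 gives a subgroup of order \<open>p\<close>, in which any nontrivial
  element will do.\<close>

lemma cauchy:
  assumes fin: "finite (carrier G)" and p: "Factorial_Ring.prime p" and dvd: "p dvd order G"
  shows "\<exists>x\<in>carrier G. x \<noteq> \<one> \<and> x [^] p = \<one>"
proof -
  obtain m where "order G = p ^ 1 * m" using dvd by auto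
  then obtain H where H: "subgroup H G" "card H = p"
    using sylow_thm[OF p is_group _ fin] by fastforce
  have "\<exists>x\<in>H. x \<noteq> \<one>"
  proof (rule ccontr)
    assume "\<not> ?thesis"
    then have "H = {\<one>}" using subgroup.one_closed[OF H(1)] by blast
    then have "p = 1" using H(2) by simp
    then show False using p by simp
  qed
  then obtain x where "x \<in> H" "x \<noteq> \<one>" by blast
  moreover have "x [^] p = \<one>" using subgroup_pow_card[OF H(1) \<open>x \<in> H\<close>] H(2) by simp
  ultimately show ?thesis using subgroup.mem_carrier[OF H(1)] by blast
qed

text \<open>As \<open>z\<close> commutes with \<open>x\<close> and \<open>g\<close>, its n-th power
  is the commutator of \<open>x [^] n\<close> with \<open>g\<close>, and also that of
  \<open>x\<close> with \<open>g [^] n\<close>.\<close>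

lemma central_commutator_pow:
  assumes x: "x \<in> carrier G" and g: "g \<in> carrier G"
    and z: "z = x \<otimes> g \<otimes> inv (g \<otimes> x)" "z \<otimes> x = x \<otimes> z" "z \<otimes> g = g \<otimes> z"
  shows "x [^] (n::nat) = \<one> \<Longrightarrow> z [^] n = \<one>" "g [^] n = \<one> \<Longrightarrow> z [^] n = \<one>"
proof -
  have zc: "z \<in> carrier G" using x g z(1) by simp
  have xg: "x \<otimes> g = z \<otimes> (g \<otimes> x)" using x g z(1) by (simp add: m_assoc)
  have gx: "g \<otimes> x = inv z \<otimes> (x \<otimes> g)" using x g zc xg by simp
  have comm: "inv z \<otimes> y = y \<otimes> inv z" if "y \<in> carrier G" "z \<otimes> y = y \<otimes> z" for y
    using that zc by (metis inv_closed inv_solve_left inv_solve_right m_assoc m_closed)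
  show "z [^] n = \<one>" if "x [^] n = \<one>"
    using pow_mult_skew[OF g x zc z(3,2) xg, of n] that g zc by simp
  show "z [^] n = \<one>" if "g [^] n = \<one>"
    using pow_mult_skew[OF x g inv_closed[OF zc] comm[OF x z(2)] comm[OF g z(3)] gx, of n] that x zc
    by (simp add: nat_pow_inv inv_eq_1_iff)
qed

text \<open>Modulo term \<open>k\<close> a commutator from term \<open>Suc k\<close> is central, so
  it is killed by both \<open>n\<close> and \<open>m\<close> and vanishes there. It therefore
  already lies in term \<open>k\<close>, and the descent ends at the trivial subgroup.\<close>

lemma commute_if_commutator_upper_central:
  assumes x: "x \<in> carrier G" and g: "g \<in> carrier G"
    and n: "x [^] n = \<one>" and m: "g [^] m = \<one>" and "coprime n (m::nat)"
  shows "x \<otimes> g \<otimes> inv (g \<otimes> x) \<in> upper_central G k \<Longrightarrow> x \<otimes> g = g \<otimes> x"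
proof (induction k)
  case 0
  then show ?case using commutator_eq_one_iff[OF x g] by simp
next
  case (Suc k)
  let ?Z = "upper_central G k" and ?Q = "G Mod upper_central G k"
  interpret Z: normal ?Z G by (rule upper_central_normal)
  interpret Q: group ?Q by (rule Z.factorgroup_is_group)
  interpret h: group_hom G ?Q "\<lambda>x. ?Z #> x"
    by (simp add: Q.group_axioms group_hom.intro group_hom_axioms.intro Z.r_coset_hom_Mod)
  define z where "z = x \<otimes> g \<otimes> inv (g \<otimes> x)"
  have zc: "z \<in> carrier G" using x g by (simp add: z_def)
  have "?Z #> z \<in> group_center ?Q" using Suc.prems by (simp add: z_def)
  then have comm: "(?Z #> z) \<otimes>\<^bsub>?Q\<^esub> (?Z #> y) = (?Z #> y) \<otimes>\<^bsub>?Q\<^esub> (?Z #> z)" if "y \<in> carrier G" for y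
    using that h.hom_closed[OF that] by (simp add: group_center_def)
  have z: "?Z #> z = (?Z #> x) \<otimes>\<^bsub>?Q\<^esub> (?Z #> g) \<otimes>\<^bsub>?Q\<^esub> inv\<^bsub>?Q\<^esub> ((?Z #> g) \<otimes>\<^bsub>?Q\<^esub> (?Z #> x))"
    unfolding z_def using x g by (metis h.hom_inv h.hom_mult inv_closed m_closed)
  note pow = Q.central_commutator_pow[OF h.hom_closed[OF x] h.hom_closed[OF g] z comm[OF x] comm[OF g]]
  have "(?Z #> z) [^]\<^bsub>?Q\<^esub> n = \<one>\<^bsub>?Q\<^esub>"
    by (rule pow(1)) (use h.hom_nat_pow[OF x, of n] n in simp)
  moreover have "(?Z #> z) [^]\<^bsub>?Q\<^esub> m = \<one>\<^bsub>?Q\<^esub>"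
    by (rule pow(2)) (use h.hom_nat_pow[OF g, of m] m in simp)
  ultimately have "?Z #> z = \<one>\<^bsub>?Q\<^esub>"
    using Q.pow_coprime_eq_one h.hom_closed[OF zc] \<open>coprime n m\<close> by blast
  then have "?Z #> z = ?Z" by simp
  then have "z \<in> ?Z" using coset_join1 zc Z.subgroup_axioms by blast
  then show ?case using Suc.IH by (simp add: z_def)
qed

section \<open>Transfer to an abelian quotient of a Sylow subgroup\<close>

text \<open>The witness is the kernel of the transfer of the quotient map from \<open>P\<close> to
  \<open>P\<close> modulo \<open>W\<close>. The target is a \<open>p\<close>-group, so
  \<open>p\<close>-regular elements are killed; an element \<open>u\<close> outside \<open>W\<close>
  is not, since its image is raised to the index of \<open>P\<close>, which is prime to
  \<open>p\<close>.\<close>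

lemma subgroup_containing_p_regular:
  assumes fin: "finite (carrier G)" and p: "Factorial_Ring.prime p" and "odd p" and dvd: "p dvd order G"
    and cent: "\<And>z g. z \<in> carrier G \<Longrightarrow> g \<in> carrier G \<Longrightarrow> z [^] p = \<one> \<Longrightarrow> z \<otimes> g = g \<otimes> z"
  shows "\<exists>K. subgroup K G \<and> K \<noteq> carrier G \<and> p_regular p G \<subseteq> K"
proof -
  have oG: "order G \<noteq> 0" using fin order_gt_0_iff_finite by simp
  define a where "a = multiplicity p (order G)"
  obtain m where m: "order G = p ^ a * m" "\<not> p dvd m"
    using multiplicity_decompose'[of "order G" p] oG p unfolding a_def
    by (metis not_prime_unit)
  have "a \<noteq> 0" using m dvd by (intro notI) simp
  obtain P where P: "subgroup P G" "card P = p ^ a"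
    using sylow_thm[OF p is_group m(1) fin] by blast
  interpret P: subgroup P G by (rule P(1))
  let ?S = "G\<lparr>carrier := P\<rparr>"
  interpret S: group ?S by (rule P.subgroup_is_group[OF is_group])
  have oS: "order ?S = p ^ a" using P by (simp add: order_def)
  have powS: "x [^]\<^bsub>?S\<^esub> n = x [^] n" for x and n :: nat by (simp add: nat_pow_def)
  have invS: "inv\<^bsub>?S\<^esub> x = inv x" if "x \<in> P" for x using m_inv_consistent[OF P(1) that] .
  \<comment> \<open>\<open>p ^ e\<close> is the exponent of \<open>P\<close>, and
    \<open>e = Suc d\<close>. Minimality of \<open>e\<close> yields the element \<open>u\<close>
    outside \<open>W\<close>.\<close>
  define e where "e = (LEAST e. \<forall>x\<in>P. x [^] p ^ e = \<one>)"
  have "\<forall>x\<in>P. x [^] p ^ a = \<one>" using subgroup_pow_card[OF P(1)] P(2) by simp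
  then have e: "\<forall>x\<in>P. x [^] p ^ e = \<one>" unfolding e_def by (rule LeastI)
  have "e \<noteq> 0"
  proof
    assume "e = 0"
    then have "P = {\<one>}" using e P.one_closed by (auto simp: nat_pow_eone)
    then have "p ^ a = 1" using P(2) by simp
    then show False using \<open>a \<noteq> 0\<close> p by auto
  qed
  then obtain d where d: "e = Suc d" by (cases e) auto
  then have "\<not> (\<forall>x\<in>P. x [^] p ^ d = \<one>)"
    using not_less_Least[of d "\<lambda>e. \<forall>x\<in>P. x [^] p ^ e = \<one>"] unfolding e_def[symmetric] by simp
  then obtain u where u: "u \<in> P" "u [^] p ^ d \<noteq> \<one>" by blast
  define W where "W = {x \<in> P. x [^] p ^ d = \<one>}"
  have WI: "x \<otimes> inv y \<in> W" if "x \<in> P" "y \<in> P" "x [^] p ^ d = y [^] p ^ d" for x y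
  proof -
    have "(x \<otimes>\<^bsub>?S\<^esub> inv\<^bsub>?S\<^esub> y) [^]\<^bsub>?S\<^esub> (p ^ d) = \<one>\<^bsub>?S\<^esub>"
    proof (rule S.pow_prime_power_eq_imp[OF p \<open>odd p\<close> oS])
      fix z g assume "z \<in> carrier ?S" "g \<in> carrier ?S" "z [^]\<^bsub>?S\<^esub> p = \<one>\<^bsub>?S\<^esub>"
      then show "z \<otimes>\<^bsub>?S\<^esub> g = g \<otimes>\<^bsub>?S\<^esub> z" using cent[of z g] by (simp add: powS)
    qed (use that powS in simp_all)
    then show ?thesis using that by (simp add: powS invS W_def)
  qed
  have WD: "x [^] p ^ d = \<one>" "x \<in> P" if "x \<in> W" for x using that by (simp_all add: W_def)
  \<comment> \<open>The \<open>p ^ d\<close>-th powers of elements of \<open>P\<close> are killed by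
    \<open>p\<close>, hence central in the whole group, not just in \<open>P\<close>. They are
    therefore unchanged by conjugation.\<close>
  have central: "x [^] p ^ d \<otimes> g = g \<otimes> x [^] p ^ d" if "x \<in> P" "g \<in> carrier G" for x g
  proof (rule cent)
    have "(x [^] p ^ d) [^] p = x [^] p ^ e"
      using that d by (simp add: nat_pow_pow mult.commute)
    then show "(x [^] p ^ d) [^] p = \<one>" using e that by simp
  qed (use that in auto)
  have conj: "(g \<otimes> x \<otimes> inv g) [^] p ^ d = x [^] p ^ d" if "x \<in> P" "g \<in> carrier G" for x g
    using that by (simp add: pow_conj inv_solve_right' flip: central)
  have subW: "subgroup W ?S"
  proof (rule S.subgroupI)
    fix x assume x: "x \<in> W"
    then show "inv\<^bsub>?S\<^esub> x \<in> W" by (simp add: W_def invS nat_pow_inv)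
    fix y assume y: "y \<in> W"
    then show "x \<otimes>\<^bsub>?S\<^esub> y \<in> W"
      using WI[of x "inv y"] x by (simp add: W_def nat_pow_inv)
  qed (auto simp: W_def intro!: exI[of _ \<one>])
  have "W \<lhd> ?S"
    unfolding S.normal_inv_iff
  proof (intro conjI ballI subW)
    fix g x assume "g \<in> carrier ?S" "x \<in> W"
    then show "g \<otimes>\<^bsub>?S\<^esub> x \<otimes>\<^bsub>?S\<^esub> inv\<^bsub>?S\<^esub> g \<in> W"
      using conj[of x g] by (auto simp: W_def invS)
  qed
  then interpret W: normal W ?S .
  let ?A = "?S Mod W" and ?\<theta> = "\<lambda>x. W #>\<^bsub>?S\<^esub> x"
  have \<theta>: "?\<theta> \<in> hom ?S ?A" by (rule W.r_coset_hom_Mod)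
  have eq: "?\<theta> x = ?\<theta> y" if "x \<in> P" "y \<in> P" "x [^] p ^ d = y [^] p ^ d" for x y
  proof -
    have "x \<otimes>\<^bsub>?S\<^esub> inv\<^bsub>?S\<^esub> y \<in> W" using WI[OF that] that invS by simp
    then show ?thesis using S.rcos_eq_iff[OF subW, of x y] that by simp
  qed
  have A: "comm_group ?A"
  proof (rule group.group_comm_groupI[OF W.factorgroup_is_group])
    fix C D assume "C \<in> carrier ?A" "D \<in> carrier ?A"
    then obtain x y where x: "x \<in> P" "C = ?\<theta> x" and y: "y \<in> P" "D = ?\<theta> y"
      by (auto simp: carrier_FactGroup)
    have "?\<theta> x \<otimes>\<^bsub>?A\<^esub> ?\<theta> y = ?\<theta> (x \<otimes> y)" "?\<theta> y \<otimes>\<^bsub>?A\<^esub> ?\<theta> x = ?\<theta> (y \<otimes> x)"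
      using hom_mult[OF \<theta>] x y by auto
    \<comment> \<open>The two products are conjugate by \<open>y\<close>, so their
      \<open>p ^ d\<close>-th powers agree, and this power determines the coset modulo
      \<open>W\<close>.\<close>
    moreover have "?\<theta> (x \<otimes> y) = ?\<theta> (y \<otimes> x)"
    proof (rule eq)
      have "y \<otimes> (x \<otimes> y) \<otimes> inv y = y \<otimes> x" using x y by (simp add: m_assoc)
      then show "(x \<otimes> y) [^] p ^ d = (y \<otimes> x) [^] p ^ d" using conj[of "x \<otimes> y" y] x y by simp
    qed (use x y in auto)
    ultimately show "C \<otimes>\<^bsub>?A\<^esub> D = D \<otimes>\<^bsub>?A\<^esub> C" using x y by simp
  qed
  have stable: "?\<theta> (g \<otimes> x \<otimes> inv g) = ?\<theta> x"
    if "x \<in> P" "g \<in> carrier G" "g \<otimes> x \<otimes> inv g \<in> P" for x g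
    by (rule eq[OF that(3,1) conj[OF that(1,2)]])
  have "\<exists>V. V \<in> hom G ?A \<and> (\<forall>x\<in>P. V x = ?\<theta> x [^]\<^bsub>?A\<^esub> card (rcosets P))"
    by (rule transfer[OF fin P(1) A \<theta> stable])
  then obtain V where V: "V \<in> hom G ?A"
    and VP: "\<And>x. x \<in> P \<Longrightarrow> V x = ?\<theta> x [^]\<^bsub>?A\<^esub> card (rcosets P)"
    by blast
  interpret A: comm_group ?A by (rule A)
  interpret V: group_hom G ?A V
    by (simp add: A.group_axioms V group_hom.intro group_hom_axioms.intro is_group)
  have Apow: "C [^]\<^bsub>?A\<^esub> p ^ a = \<one>\<^bsub>?A\<^esub>" if C: "C \<in> carrier ?A" for C
  proof -
    obtain l where "p ^ a = order ?A * l" using S.order_FactGroup_dvd[OF subW] oS by (auto elim: dvdE)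
    then show ?thesis using A.pow_order_eq_1[OF C] C by (metis A.nat_pow_one A.nat_pow_pow)
  qed
  have Atriv: "C = \<one>\<^bsub>?A\<^esub>" if "C \<in> carrier ?A" "C [^]\<^bsub>?A\<^esub> l = \<one>\<^bsub>?A\<^esub>" "coprime p l" for C and l :: nat
    using A.pow_coprime_eq_one[OF that(1) Apow[OF that(1)] that(2)] that(3) by simp
  let ?K = "kernel G ?A V"
  have "subgroup ?K G" by (rule V.subgroup_kernel)
  moreover have "p_regular p G \<subseteq> ?K"
  proof
    fix g assume "g \<in> p_regular p G"
    then obtain l where l: "g \<in> carrier G" "g [^] l = \<one>" "coprime p l" by (auto simp: p_regular_def)
    have "V g [^]\<^bsub>?A\<^esub> l = \<one>\<^bsub>?A\<^esub>" using l V.hom_nat_pow[of g l] V.hom_one by simp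
    then show "g \<in> ?K" using Atriv[of "V g" l] l V.hom_closed by (simp add: kernel_def)
  qed
  moreover have "u \<notin> ?K"
  proof
    assume "u \<in> ?K"
    then have "?\<theta> u [^]\<^bsub>?A\<^esub> card (rcosets P) = \<one>\<^bsub>?A\<^esub>" using VP[OF u(1)] by (simp add: kernel_def)
    moreover have "card (rcosets P) = m"
      using lagrange[OF P(1)] m P(2) p by (simp add: prime_gt_0_nat)
    moreover have "coprime p m" using m p prime_imp_coprime by blast
    moreover have "?\<theta> u \<in> carrier ?A" using u by (auto simp: carrier_FactGroup)
    ultimately have "?\<theta> u = \<one>\<^bsub>?A\<^esub>" using Atriv by blast
    then have "?\<theta> u = W" by simp
    then have "u \<in> W" using S.coset_join1[OF _ _ subW] u by simp
    then show False using WD u by blast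
  qed
  ultimately show ?thesis using u by (metis P.mem_carrier)
qed

text \<open>This moves the problem into a subgroup, used for the kernel of the transfer and for the
  centralizer of the elements killed by \<open>p\<close>.\<close>

lemma subgroup_p_regular_if_subgroup:
  assumes K: "subgroup K G" "p_regular p G \<subseteq> K"
    and reg: "subgroup (p_regular p (G\<lparr>carrier := K\<rparr>)) (G\<lparr>carrier := K\<rparr>)"
  shows "subgroup (p_regular p G) G"
  using incl_subgroup[OF K(1) reg] p_regular_carrier_update[OF subgroup.subset[OF K(1)], of p] K(2)
  by (simp add: Int_absorb2)

end

text \<open>Stated outside the locale because the induction on the order varies the group. The
  centrality hypothesis is inherited by \<open>K\<close>; if \<open>p\<close> does not divide the
  order, every element is \<open>p\<close>-regular.\<close>

lemma subgroup_p_regular_if_central: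
  assumes "group G" "finite (carrier G)" "Factorial_Ring.prime p" "odd p"
    and "\<And>z g. z \<in> carrier G \<Longrightarrow> g \<in> carrier G \<Longrightarrow> z [^]\<^bsub>G\<^esub> p = \<one>\<^bsub>G\<^esub> \<Longrightarrow> z \<otimes>\<^bsub>G\<^esub> g = g \<otimes>\<^bsub>G\<^esub> z"
  shows "subgroup (p_regular p G) G"
  using assms
proof (induction "order G" arbitrary: G rule: less_induct)
  case less
  interpret group G by fact
  show ?case
  proof (cases "p dvd order G")
    case True
    obtain K where K: "subgroup K G" "K \<noteq> carrier G" "p_regular p G \<subseteq> K"
      using subgroup_containing_p_regular[OF less.prems(2-4) True less.prems(5)] by blast
    have sub: "K \<subseteq> carrier G" using K(1) by (rule subgroup.subset)
    have "subgroup (p_regular p (G\<lparr>carrier := K\<rparr>)) (G\<lparr>carrier := K\<rparr>)"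
    proof (rule less.hyps)
      show "order (G\<lparr>carrier := K\<rparr>) < order G"
        using sub K(2) less.prems(2) by (auto simp: order_def intro: psubset_card_mono)
      show "group (G\<lparr>carrier := K\<rparr>)" using K(1) is_group by (rule subgroup.subgroup_is_group)
      show "finite (carrier (G\<lparr>carrier := K\<rparr>))" using sub less.prems(2) by (simp add: finite_subset)
    qed (use less.prems sub in \<open>auto simp: nat_pow_def\<close>)
    then show ?thesis by (rule subgroup_p_regular_if_subgroup[OF K(1,3)])
  next
    case False
    then have "coprime p (order G)" using less.prems(3) prime_imp_coprime by blast
    then have "p_regular p G = carrier G" by (auto simp: p_regular_def intro: pow_order_eq_1)
    then show ?thesis using subgroup_self by simp
  qed
qed

section \<open>The normal complement\<close>

text \<open>By Cauchy's theorem \<open>?N\<close> has order prime to \<open>p\<close> and the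
  quotient by it is a \<open>p\<close>-group. So the quotient has the same order as
  \<open>P\<close>, and counting products gives the whole group.\<close>

lemma (in group) normal_complement_p_regular:
  assumes fin: "finite (carrier G)" and p: "Factorial_Ring.prime p"
    and N: "subgroup (p_regular p G) G" and P: "P \<in> Syl p G"
  shows "normal_complement (p_regular p G) P G"
proof -
  let ?N = "p_regular p G"
  define a where "a = multiplicity p (order G)"
  have oG: "order G \<noteq> 0" using fin order_gt_0_iff_finite by simp
  have P: "subgroup P G" "card P = p ^ a" using P by (auto simp: Syl_def a_def)
  have normal: "?N \<lhd> G"
    unfolding normal_inv_iff
  proof (intro conjI N ballI)
    fix g x assume g: "g \<in> carrier G" and "x \<in> ?N"
    then obtain m where m: "x \<in> carrier G" "coprime p m" "x [^] m = \<one>" by (auto simp: p_regular_def)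
    then show "g \<otimes> x \<otimes> inv g \<in> ?N"
      using g by (auto simp: p_regular_def pow_conj intro!: exI[of _ m])
  qed
  have triv: "x = \<one>" if x: "x \<in> ?N" "x [^] p ^ b = \<one>" for x b
  proof -
    obtain m where m: "x \<in> carrier G" "coprime p m" "x [^] m = \<one>"
      using x(1) by (auto simp: p_regular_def)
    then show ?thesis using pow_coprime_eq_one[OF m(1) x(2) m(3)] by simp
  qed
  interpret N: normal ?N G by (rule normal)
  have inter: "?N \<inter> P = {\<one>}"
    using triv[of _ a] subgroup_pow_card[OF P(1), unfolded P(2)] N.one_closed subgroup.one_closed[OF P(1)]
    by blast
  have pN: "\<not> p dvd card ?N"
  proof
    assume dvd: "p dvd card ?N"
    interpret H: group "G\<lparr>carrier := ?N\<rparr>" by (rule N.subgroup_is_group[OF is_group])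
    have "finite ?N" using fin N.subset finite_subset by blast
    then obtain x where "x \<in> ?N" "x \<noteq> \<one>" "x [^] p = \<one>"
      using H.cauchy[OF _ p] dvd by (auto simp: order_def nat_pow_def)
    then show False using triv[of x 1] by simp
  qed
  let ?Q = "G Mod ?N"
  interpret Q: group ?Q by (rule N.factorgroup_is_group)
  interpret h: group_hom G ?Q "\<lambda>x. ?N #> x"
    by (simp add: Q.group_axioms group_hom.intro group_hom_axioms.intro N.r_coset_hom_Mod)
  have lag: "order ?Q * card ?N = order G"
    using lagrange[OF N] by (simp add: order_def FactGroup_def)
  then have oQ: "order ?Q \<noteq> 0" using oG by (metis mult_zero_left)
  then have finQ: "finite (carrier ?Q)" using Q.order_gt_0_iff_finite by simp
  obtain s where s: "order ?Q = p ^ multiplicity p (order ?Q) * s" "\<not> p dvd s"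
    using multiplicity_decompose'[OF oQ, of p] p by (metis not_prime_unit)
  \<comment> \<open>Otherwise some coset \<open>C\<close> of an element \<open>x\<close> has prime
    order \<open>r\<close> different from \<open>p\<close>. But \<open>x [^] p ^ a\<close> is
    \<open>p\<close>-regular, its \<open>m\<close>-th power being \<open>x [^] order G\<close>, so
    \<open>C\<close> is also killed by \<open>p ^ a\<close>.\<close>
  have "s = 1"
  proof (rule ccontr)
    assume "s \<noteq> 1"
    then obtain r where r: "Factorial_Ring.prime r" "r dvd s" using prime_factor_nat by blast
    then have rp: "coprime p r" using s(2) p primes_coprime by metis
    have "r dvd order ?Q" using r s(1) by (metis dvd_mult)
    then obtain C where C: "C \<in> carrier ?Q" "C \<noteq> \<one>\<^bsub>?Q\<^esub>" "C [^]\<^bsub>?Q\<^esub> r = \<one>\<^bsub>?Q\<^esub>"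
      using Q.cauchy[OF finQ r(1)] by blast
    then obtain x where x: "x \<in> carrier G" "C = ?N #> x" by (auto simp: carrier_FactGroup)
    obtain m where m: "order G = p ^ a * m" "\<not> p dvd m"
      using multiplicity_decompose'[OF oG, of p] p unfolding a_def by (metis not_prime_unit)
    have "(x [^] p ^ a) [^] m = \<one>"
      using x m pow_order_eq_1[OF x(1)] by (simp add: nat_pow_pow)
    moreover have "coprime p m" using m(2) p prime_imp_coprime by blast
    ultimately have "x [^] p ^ a \<in> ?N" using x(1) unfolding p_regular_def by blast
    then have "?N #> (x [^] p ^ a) = ?N" using N.rcos_const[OF is_group] by blast
    then have "C [^]\<^bsub>?Q\<^esub> p ^ a = \<one>\<^bsub>?Q\<^esub>" using h.hom_nat_pow[OF x(1), of "p ^ a"] x by simp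
    then show False
      using Q.pow_coprime_eq_one[OF C(1) _ C(3)] C(2) rp by simp
  qed
  then obtain j where j: "order ?Q = p ^ j" using s by auto
  have "a = j"
  proof -
    have "a = multiplicity p (p ^ j * card ?N)" using lag j by (simp add: a_def)
    also have "\<dots> = j" using p pN oG lag
      by (subst prime_elem_multiplicity_mult_distrib)
         (auto simp: not_dvd_imp_multiplicity_0 intro!: Nat.gr0I)
    finally show ?thesis .
  qed
  have "card (?N <#> P) = card ?N * card P"
  proof -
    have "?N <#> P = (\<lambda>(n, x). n \<otimes> x) ` (?N \<times> P)" by (auto simp: set_mult_def)
    moreover have "inj_on (\<lambda>(n, x). n \<otimes> x) (?N \<times> P)"
    proof (intro inj_onI, clarify)
      fix n x n' x' assume nx: "n \<in> ?N" "x \<in> P" "n' \<in> ?N" "x' \<in> P" and eq: "n \<otimes> x = n' \<otimes> x'"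
      have c: "n \<in> carrier G" "n' \<in> carrier G" "x \<in> carrier G" "x' \<in> carrier G"
        using nx subgroup.mem_carrier[OF P(1)] N.mem_carrier by auto
      have "inv n' \<otimes> (n \<otimes> x) \<otimes> inv x = inv n' \<otimes> (n' \<otimes> x') \<otimes> inv x" using eq by simp
      then have e: "inv n' \<otimes> n = x' \<otimes> inv x" using c by (simp add: m_assoc)
      moreover have "inv n' \<otimes> n \<in> ?N" using nx by simp
      moreover have "x' \<otimes> inv x \<in> P" using nx P(1) by (simp add: subgroup.m_closed subgroup.m_inv_closed)
      ultimately have "inv n' \<otimes> n = \<one>" using inter by auto
      then have "n = n'" "x' = x" using e c by (metis inv_equality inv_inv inv_closed, metis inv_equality inv_inv inv_closed)
      then show "n = n' \<and> x = x'" by simp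
    qed
    ultimately show ?thesis by (simp add: card_image card_cartesian_product)
  qed
  also have "\<dots> = order G" using lag j \<open>a = j\<close> P(2) by (simp add: mult.commute)
  finally have "?N <#> P = carrier G"
    using fin N.subset subgroup.subset[OF P(1)] by (intro card_subset_eq setmult_subset_G) (auto simp: order_def)
  then show ?thesis using normal inter by (simp add: normal_complement_def)
qed

section \<open>Reduction to central elements of order p\<close>

text \<open>\<open>C\<close> is the centralizer of all elements killed by \<open>p\<close>. It
  contains every \<open>p\<close>-regular element by
  \<open>commute_if_commutator_upper_central\<close>, and those of its own elements that are killed
  by \<open>p\<close> are central in it, so the previous case applies to \<open>C\<close>.\<close>

lemma (in group) subgroup_p_regular:
  assumes fin: "finite (carrier G)" and p: "Factorial_Ring.prime p" and "odd p"
    and central: "p_central G p k"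
  shows "subgroup (p_regular p G) G"
proof -
  define C where "C = {y \<in> carrier G. \<forall>x\<in>carrier G. x [^] p = \<one> \<longrightarrow> x \<otimes> y = y \<otimes> x}"
  have subC: "C \<subseteq> carrier G" by (auto simp: C_def)
  have C: "subgroup C G"
  proof (rule subgroupI)
    fix y assume y: "y \<in> C"
    then show "inv y \<in> C"
      by (auto simp: C_def) (metis inv_closed inv_solve_left inv_solve_right m_assoc m_closed)
    fix y' assume "y' \<in> C"
    then show "y \<otimes> y' \<in> C" using y by (auto simp: C_def) (metis m_assoc)
  qed (auto simp: C_def)
  have "p_regular p G \<subseteq> C"
  proof
    fix g assume "g \<in> p_regular p G"
    then obtain m where g: "g \<in> carrier G" and m: "coprime p m" "g [^] m = \<one>"
      by (auto simp: p_regular_def)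
    have "x \<otimes> g = g \<otimes> x" if x: "x \<in> carrier G" "x [^] p = \<one>" for x
    proof (rule commute_if_commutator_upper_central[OF x(1) g x(2) m(2,1)])
      interpret Z: normal "upper_central G k" G by (rule upper_central_normal)
      have "x \<in> Omega G p 1" using x by (auto simp: Omega_def intro: generate.incl)
      then have "x \<in> upper_central G k" using central by (auto simp: p_pow_central_def)
      \<comment> \<open>The commutator of \<open>x\<close> and \<open>g\<close> is \<open>x\<close>
        times a conjugate of \<open>inv x\<close>, so it lies in any normal subgroup containing
        \<open>x\<close>.\<close>
      then have "x \<otimes> (g \<otimes> inv x \<otimes> inv g) \<in> upper_central G k"
        using Z.inv_op_closed2[OF g] by blast
      then show "x \<otimes> g \<otimes> inv (g \<otimes> x) \<in> upper_central G k"
        using x g by (simp add: m_assoc inv_mult_group)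
    qed
    then show "g \<in> C" using g by (simp add: C_def)
  qed
  moreover have "subgroup (p_regular p (G\<lparr>carrier := C\<rparr>)) (G\<lparr>carrier := C\<rparr>)"
  proof (rule subgroup_p_regular_if_central[OF _ _ p \<open>odd p\<close>])
    show "group (G\<lparr>carrier := C\<rparr>)" using C is_group by (rule subgroup.subgroup_is_group)
    show "finite (carrier (G\<lparr>carrier := C\<rparr>))" using subC fin by (simp add: finite_subset)
  qed (auto simp: C_def nat_pow_def)
  ultimately show ?thesis
    by (intro subgroup_p_regular_if_subgroup[OF C])
qed

theorem theoremA:
  fixes G :: "('a, 'b) monoid_scheme" and p k :: nat
  assumes "group G" and "finite (carrier G)"
    and "Factorial_Ring.prime p" and "odd p" and "k \<ge> 1"
    and "p_central G p k"
  shows "p_nilpotent p G"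
proof -
  interpret group G by fact
  have "subgroup (p_regular p G) G"
    using assms(2,3,4,6) by (rule subgroup_p_regular)
  then show ?thesis
    using normal_complement_p_regular[OF assms(2,3)] unfolding p_nilpotent_def by blast
qed

end
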